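(* Let $q$ be a prime power, $t\ge1$, $F=\mathbb{F}_{q^t}$, $A\subseteq F$ with $|A|=n\le q^t$, and let $k$ satisfy $r=n-k\ge q^s$ for some integer $s<t$. Let $\{u_1,\dots,u_t\}$ be an $\mathbb{F}_q$-basis of $F$, $W$ an arbitrary $\mathbb{F}_q$-subspace of $F$ of dimension $s$, $L_W(x)=\prod_{w\in W}(x-w)$, $\alpha^*\in A$, and $g_i(x)=L_W\big(u_i(x-\alpha^* )\big)/(x-\alpha^* )$ for $i=1,\dots,t$ (polynomials of degree $q^s-1\le r-1$). Then the check polynomials $g_1,\dots,g_t$ yield a linear repair scheme over $\mathbb{F}_q$ for the codeword symbol $f(\alpha^* )$ of the Reed-Solomon code $\mathrm{RS}(A,k)$ with repair bandwidth at most $(n-1)(t-s)\log_2 q$ bits. Moreover, when $n=|F|=q^t$ and $r=q^s$, this repair bandwidth is optimal among linear repair schemes over $\mathbb{F}_q$.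
   Context: $\mathrm{RS}(A,k)=\{(f(\alpha))_{\alpha\in A} : f\in F[x],\ \deg f<k\}$, with $f(\alpha)$ stored at node $\alpha$. Every polynomial $g\in F[x]$ of degree at most $r-1$ gives a dual codeword (a check): $\sum_{\alpha\in A}\lambda_\alpha g(\alpha)f(\alpha)=0$ for fixed nonzero multipliers $\lambda_\alpha$. Given checks $g_1,\dots,g_t$ of degree at most $r-1$ with $\mathrm{rank}_{\mathbb{F}_q}\{g_i(\alpha^* )\}_i=t$, one obtains a linear repair scheme over $\mathbb{F}_q$: applying $\mathrm{Tr}_{F/\mathbb{F}_q}$ to the check equations, the replacement node recovers $t$ independent traces of $f(\alpha^* )$ by downloading from each node $\alpha\ne\alpha^*$ exactly $b_\alpha=\mathrm{rank}_{\mathbb{F}_q}\{g_1(\alpha),\dots,g_t(\alpha)\}$ sub-symbols of $\mathbb{F}_q$; the repair bandwidth is $\sum_{\alpha\neq\alpha^*}b_\alpha$ sub-symbols, i.e. $\log_2 q$ times that many bits. In general a linear repair scheme over $\mathbb{F}_q$ is one where each node sends $\mathbb{F}_q$-linear functions of its symbol and $f(\alpha^* )$ is recovered $\mathbb{F}_q$-linearly; its bandwidth is the total amount downloaded. *)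

theory Defs
  imports "HOL-Computational_Algebra.Polynomial" "HOL-Computational_Algebra.Primes" Complex_Main
begin

definition is_subfield :: "'a::field set \<Rightarrow> bool" where
  "is_subfield K \<longleftrightarrow> 0 \<in> K \<and> 1 \<in> K \<and>
     (\<forall>x\<in>K. \<forall>y\<in>K. x + y \<in> K \<and> x * y \<in> K) \<and>
     (\<forall>x\<in>K. - x \<in> K \<and> inverse x \<in> K)"

definition ksubspace :: "'a::field set \<Rightarrow> 'a set \<Rightarrow> bool" where
  "ksubspace K W \<longleftrightarrow> 0 \<in> W \<and> (\<forall>x\<in>W. \<forall>y\<in>W. x + y \<in> W) \<and>
     (\<forall>a\<in>K. \<forall>x\<in>W. a * x \<in> W)"

definition kspan :: "'a::field set \<Rightarrow> 'a set \<Rightarrow> 'a set" where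
  "kspan K S = {(\<Sum>x\<in>T. c x * x) | T c. finite T \<and> T \<subseteq> S \<and> (\<forall>x\<in>T. c x \<in> K)}"

definition kindep :: "'a::field set \<Rightarrow> 'a set \<Rightarrow> bool" where
  "kindep K S \<longleftrightarrow> (\<forall>T c. finite T \<and> T \<subseteq> S \<and> (\<forall>x\<in>T. c x \<in> K) \<and> (\<Sum>x\<in>T. c x * x) = 0
      \<longrightarrow> (\<forall>x\<in>T. c x = 0))"

definition kdim :: "'a::field set \<Rightarrow> 'a set \<Rightarrow> nat" where
  "kdim K V = (LEAST m. \<exists>B. finite B \<and> card B = m \<and> B \<subseteq> V \<and> kspan K B = V)"

definition krank :: "'a::field set \<Rightarrow> 'a set \<Rightarrow> nat" where
  "krank K S = kdim K (kspan K S)"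

definition klinear_functional :: "'a::field set \<Rightarrow> ('a \<Rightarrow> 'a) \<Rightarrow> bool" where
  "klinear_functional K \<phi> \<longleftrightarrow> (\<forall>x. \<phi> x \<in> K) \<and> (\<forall>x y. \<phi> (x + y) = \<phi> x + \<phi> y) \<and>
     (\<forall>a\<in>K. \<forall>x. \<phi> (a * x) = a * \<phi> x)"

definition RS :: "'a::field set \<Rightarrow> nat \<Rightarrow> ('a \<Rightarrow> 'a) set" where
  "RS A k = {c. \<exists>f. (f = 0 \<or> degree f < k) \<and> (\<forall>\<alpha>\<in>A. c \<alpha> = poly f \<alpha>) \<and> (\<forall>\<alpha>. \<alpha> \<notin> A \<longrightarrow> c \<alpha> = 0)}"

definition download ::
  "'a::zero set \<Rightarrow> 'a \<Rightarrow> ('a \<Rightarrow> nat) \<Rightarrow> ('a \<Rightarrow> nat \<Rightarrow> 'a \<Rightarrow> 'a) \<Rightarrow> ('a \<Rightarrow> 'a) \<Rightarrow> 'a \<Rightarrow> nat \<Rightarrow> 'a" where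
  "download A \<alpha>s b Q c = (\<lambda>\<alpha> j. if \<alpha> \<in> A - {\<alpha>s} \<and> j < b \<alpha> then Q \<alpha> j (c \<alpha>) else 0)"

definition download_space :: "'a::field set \<Rightarrow> 'a set \<Rightarrow> 'a \<Rightarrow> ('a \<Rightarrow> nat) \<Rightarrow> ('a \<Rightarrow> nat \<Rightarrow> 'a) set" where
  "download_space K A \<alpha>s b = {d. \<forall>\<alpha> j. d \<alpha> j \<in> K \<and> (\<not> (\<alpha> \<in> A - {\<alpha>s} \<and> j < b \<alpha>) \<longrightarrow> d \<alpha> j = 0)}"

text \<open>A linear repair scheme over K for node alpha_s of the code C (evaluation set A),
  in which node alpha sends b alpha sub-symbols (elements of K), each a K-linear function of
  its symbol, and the lost symbol is recovered by a K-linear map of the downloaded data.\<close>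
definition linear_repair_scheme ::
  "'a::field set \<Rightarrow> 'a set \<Rightarrow> ('a \<Rightarrow> 'a) set \<Rightarrow> 'a \<Rightarrow> ('a \<Rightarrow> nat) \<Rightarrow> bool" where
  "linear_repair_scheme K A C \<alpha>s b \<longleftrightarrow>
     (\<exists>Q R.
        (\<forall>\<alpha>\<in>A - {\<alpha>s}. \<forall>j < b \<alpha>. klinear_functional K (Q \<alpha> j)) \<and>
        (\<forall>d\<in>download_space K A \<alpha>s b. \<forall>e\<in>download_space K A \<alpha>s b.
            R (\<lambda>\<alpha> j. d \<alpha> j + e \<alpha> j) = R d + R e) \<and>
        (\<forall>a\<in>K. \<forall>d\<in>download_space K A \<alpha>s b. R (\<lambda>\<alpha> j. a * d \<alpha> j) = a * R d) \<and>
        (\<forall>c\<in>C. R (download A \<alpha>s b Q c) = c \<alpha>s))"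

definition bandwidth_bits :: "'a set \<Rightarrow> 'a \<Rightarrow> ('a \<Rightarrow> nat) \<Rightarrow> nat \<Rightarrow> real" where
  "bandwidth_bits A \<alpha>s b q = real (\<Sum>\<alpha>\<in>A - {\<alpha>s}. b \<alpha>) * log 2 (real q)"

definition subspace_poly :: "'a::field set \<Rightarrow> 'a poly" where
  "subspace_poly W = (\<Prod>w\<in>W. [:- w, 1:])"

definition check_poly :: "'a::field set \<Rightarrow> 'a \<Rightarrow> 'a \<Rightarrow> 'a poly" where
  "check_poly W u a = pcompose (subspace_poly W) [:- (u * a), u:] div [:- a, 1:]"

end

theory Submission
  imports Defs "HOL-Library.FuncSet"
begin

text \<open>
  The trace is replaced throughout by an arbitrary nonzero \<open>K\<close>-linear functional \<open>\<psi>\<close> on \<open>F\<close>: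
  \<open>(x, y) \<mapsto> \<psi> (x * y)\<close> is nondegenerate, so by counting every functional has the form
  \<open>x \<mapsto> \<psi> (\<delta> * x)\<close>, and an element can be recovered from the values \<open>\<psi> (b * x)\<close> on a basis.

  Upper bound: \<open>L\<^sub>W\<close> is \<open>K\<close>-linear with kernel \<open>W\<close>, so away from \<open>\<alpha>s\<close> the values of the checks
  lie in a scaled copy of its image, which has dimension \<open>t - s\<close>.

  Lower bound: composing a repair scheme with \<open>\<psi>\<close> gives, for each \<open>\<gamma> \<in> F\<close>, a dual word with entry
  \<open>\<gamma>\<close> at \<open>\<alpha>s\<close>. It has at most \<open>r - 1\<close> zeros if \<open>\<gamma> \<noteq> 0\<close>, while at least \<open>q ^ (t - b \<alpha>)\<close> of the words
  vanish at node \<open>\<alpha>\<close>. Counting zeros in both ways and using convexity of \<open>y \<mapsto> q\<^sup>y\<close> bounds the sum of \<open>b\<close>.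
\<close>

section \<open>Linear algebra over a finite subfield\<close>

text \<open>Since the type is finite, dimension arguments become counting: a subspace of dimension
  \<open>d\<close> has \<open>card K ^ d\<close> elements, so rank bounds are read off from
  cardinalities.\<close>

locale finite_subfield =
  fixes K :: "'a::{finite,field} set"
  assumes is_subfield: "is_subfield K"
begin

lemma zero_mem [simp]: "0 \<in> K" and one_mem [simp]: "1 \<in> K"
  and add_mem: "x \<in> K \<Longrightarrow> y \<in> K \<Longrightarrow> x + y \<in> K"
  and mult_mem: "x \<in> K \<Longrightarrow> y \<in> K \<Longrightarrow> x * y \<in> K"
  and minus_mem: "x \<in> K \<Longrightarrow> - x \<in> K"
  and inverse_mem: "x \<in> K \<Longrightarrow> inverse x \<in> K"
  using is_subfield by (auto simp: is_subfield_def)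

lemma diff_mem: "x \<in> K \<Longrightarrow> y \<in> K \<Longrightarrow> x - y \<in> K"
  using add_mem[of x "- y"] minus_mem[of y] by simp

lemma sum_mem: "(\<And>i. i \<in> I \<Longrightarrow> f i \<in> K) \<Longrightarrow> sum f I \<in> K"
  by (induction I rule: infinite_finite_induct) (auto intro: add_mem)

lemma card_ge_2: "card K \<ge> 2"
proof -
  have "card {0, 1 :: 'a} \<le> card K" by (intro card_mono) auto
  then show ?thesis by simp
qed

text \<open>Multiplication by a nonzero \<open>a\<close> permutes \<open>K - {0}\<close>; comparing
  the product over this set with itself leaves \<open>a ^ (card K - 1) = 1\<close>.\<close>

lemma power_card_eq: "a \<in> K \<Longrightarrow> a ^ card K = a"
proof (cases "a = 0")
  case True
  then show ?thesis using card_ge_2 by (metis not_numeral_le_zero power_0_left)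
next
  case False
  assume a: "a \<in> K"
  let ?U = "K - {0}"
  have "bij_betw ((*) a) ?U ?U"
    using a False
    by (intro bij_betwI[where g = "(*) (inverse a)"]) (auto simp: mult_mem inverse_mem)
  then have "(\<Prod>x\<in>?U. a * x) = \<Prod>?U"
    by (rule prod.reindex_bij_betw)
  then have "a ^ card ?U = 1"
    by (simp add: prod.distrib)
  moreover have "card K = Suc (card ?U)"
    by (metis card.remove finite zero_mem)
  ultimately show ?thesis by (metis mult.right_neutral power_Suc)
qed

lemma power_card_power_eq: "a \<in> K \<Longrightarrow> a ^ (card K ^ m) = a"
  by (induction m) (auto simp: power_mult power_card_eq)

lemma kspan_eq: "kspan K S = {(\<Sum>x\<in>S. c x * x) | c. \<forall>x\<in>S. c x \<in> K}"
proof (intro equalityI subsetI)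
  fix y assume "y \<in> kspan K S"
  then obtain T c where T: "T \<subseteq> S" "\<forall>x\<in>T. c x \<in> K" "y = (\<Sum>x\<in>T. c x * x)"
    by (auto simp: kspan_def)
  define d where "d x = (if x \<in> T then c x else 0)" for x
  have "y = (\<Sum>x\<in>S. d x * x)"
    unfolding T(3) by (rule sum.mono_neutral_cong_left) (use T in \<open>auto simp: d_def\<close>)
  moreover have "\<forall>x\<in>S. d x \<in> K" using T by (auto simp: d_def)
  ultimately show "y \<in> {(\<Sum>x\<in>S. c x * x) | c. \<forall>x\<in>S. c x \<in> K}" by blast
next
  fix y assume "y \<in> {(\<Sum>x\<in>S. c x * x) | c. \<forall>x\<in>S. c x \<in> K}"
  then show "y \<in> kspan K S" unfolding kspan_def using finite[of S] by blast
qed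

lemma ksubspace_sum:
  assumes "ksubspace K V" "\<And>i. i \<in> I \<Longrightarrow> c i \<in> K" "\<And>i. i \<in> I \<Longrightarrow> f i \<in> V"
  shows "(\<Sum>i\<in>I. c i * f i) \<in> V"
  using assms(2,3)
  by (induction I rule: infinite_finite_induct)
    (use assms(1) in \<open>auto simp: ksubspace_def\<close>)

lemma kspan_minimal: "ksubspace K V \<Longrightarrow> S \<subseteq> V \<Longrightarrow> kspan K S \<subseteq> V"
  unfolding kspan_eq by (auto intro: ksubspace_sum)

lemma kspan_superset: "S \<subseteq> kspan K S"
proof
  fix x assume "x \<in> S"
  have "(\<Sum>y\<in>{x}. 1 * y) \<in> kspan K S"
    unfolding kspan_def mem_Collect_eq
    by (intro exI[of _ "{x}"] exI[of _ "\<lambda>_. 1"] conjI) (use \<open>x \<in> S\<close> in auto)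
  then show "x \<in> kspan K S" by simp
qed

lemma ksubspace_kspan: "ksubspace K (kspan K S)"
  unfolding ksubspace_def
proof (intro conjI ballI)
  show "0 \<in> kspan K S" unfolding kspan_eq by (auto intro!: exI[of _ "\<lambda>_. 0"])
next
  fix x y assume "x \<in> kspan K S" "y \<in> kspan K S"
  then obtain c d where "\<forall>x\<in>S. c x \<in> K" "\<forall>x\<in>S. d x \<in> K"
    "x = (\<Sum>x\<in>S. c x * x)" "y = (\<Sum>x\<in>S. d x * x)" unfolding kspan_eq by blast
  then show "x + y \<in> kspan K S" unfolding kspan_eq
    by (auto intro!: exI[of _ "\<lambda>x. c x + d x"] add_mem simp: sum.distrib algebra_simps)
next
  fix a x assume "a \<in> K" "x \<in> kspan K S"
  then obtain c where "\<forall>x\<in>S. c x \<in> K" "x = (\<Sum>x\<in>S. c x * x)" unfolding kspan_eq by blast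
  then show "a * x \<in> kspan K S" unfolding kspan_eq using \<open>a \<in> K\<close>
    by (auto intro!: exI[of _ "\<lambda>x. a * c x"] mult_mem simp: sum_distrib_left algebra_simps)
qed

lemma kspan_of_ksubspace: "ksubspace K V \<Longrightarrow> kspan K V = V"
  using kspan_minimal[of V V] kspan_superset[of V] by blast

lemma kindep_coeffs_unique:
  assumes "kindep K S" "\<forall>x\<in>S. c x \<in> K" "\<forall>x\<in>S. d x \<in> K"
    and "(\<Sum>x\<in>S. c x * x) = (\<Sum>x\<in>S. d x * x)" "x \<in> S"
  shows "c x = d x"
proof -
  have "(\<Sum>x\<in>S. (c x - d x) * x) = 0"
    using assms(4) by (simp add: left_diff_distrib sum_subtractf)
  moreover have "\<forall>x\<in>S. c x - d x \<in> K" using assms(2,3) diff_mem by blast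
  ultimately have "\<forall>x\<in>S. c x - d x = 0"
    using assms(1)[unfolded kindep_def, rule_format, of S "\<lambda>x. c x - d x"] by simp
  then show ?thesis using assms(5) by simp
qed

text \<open>Independence makes a linear combination determine its coefficient vector. Taking the
  vectors in \<open>S \<rightarrow>\<^sub>E K\<close> fixes their values off \<open>S\<close>, so
  they can be counted.\<close>

lemma card_kspan:
  assumes "kindep K S" shows "card (kspan K S) = card K ^ card S"
proof -
  let ?f = "\<lambda>c. \<Sum>x\<in>S. c x * x"
  have "inj_on ?f (S \<rightarrow>\<^sub>E K)"
  proof (rule inj_onI)
    fix c d assume "c \<in> S \<rightarrow>\<^sub>E K" "d \<in> S \<rightarrow>\<^sub>E K" "?f c = ?f d"
    then show "c = d"
      by (intro PiE_ext[of c S "\<lambda>_. K" d] kindep_coeffs_unique[OF assms, of c d]) auto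
  qed
  moreover have "kspan K S = ?f ` (S \<rightarrow>\<^sub>E K)"
  proof (intro equalityI subsetI)
    fix y assume "y \<in> kspan K S"
    then obtain c where "\<forall>x\<in>S. c x \<in> K" "y = ?f c" unfolding kspan_eq by blast
    then show "y \<in> ?f ` (S \<rightarrow>\<^sub>E K)" by (intro image_eqI[of _ _ "restrict c S"]) auto
  qed (auto simp: kspan_eq)
  ultimately show ?thesis by (simp add: card_image card_PiE)
qed

text \<open>A spanning set of least size is independent: a vector with nonzero coefficient in a
  relation lies in the span of the others and could be removed.\<close>

lemma kdim_basis:
  assumes V: "ksubspace K V"
  obtains B where "B \<subseteq> V" "card B = kdim K V" "kspan K B = V" "kindep K B"
proof -
  let ?P = "\<lambda>m. \<exists>B. finite B \<and> card B = m \<and> B \<subseteq> V \<and> kspan K B = V"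
  have "?P (card V)" using kspan_of_ksubspace[OF V] by auto
  then have "?P (kdim K V)" unfolding kdim_def by (rule LeastI)
  then obtain B where B: "card B = kdim K V" "B \<subseteq> V" "kspan K B = V" by auto
  have least: "kdim K V \<le> card C" if "C \<subseteq> V" "kspan K C = V" for C
    unfolding kdim_def using that by (intro Least_le) auto
  have "kindep K B"
    unfolding kindep_def
  proof (intro allI impI ballI; elim conjE)
    fix T c y
    assume T: "T \<subseteq> B" "\<forall>x\<in>T. c x \<in> K" "(\<Sum>x\<in>T. c x * x) = 0" and y: "y \<in> T"
    show "c y = 0"
    proof (rule ccontr)
      assume c: "c y \<noteq> 0"
      let ?S = "kspan K (B - {y})"
      have "c y * y + (\<Sum>x\<in>T - {y}. c x * x) = 0"
        using T(3) y by (simp add: sum.remove)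
      then have "c y * y = - (\<Sum>x\<in>T - {y}. c x * x)" by (simp add: eq_neg_iff_add_eq_0)
      then have "y = - inverse (c y) * (\<Sum>x\<in>T - {y}. c x * x)"
        using c by (simp add: field_simps)
      moreover have "(\<Sum>x\<in>T - {y}. c x * x) \<in> ?S"
        using T kspan_superset[of "B - {y}"] by (intro ksubspace_sum[OF ksubspace_kspan]) auto
      moreover have "- inverse (c y) \<in> K" using T y by (simp add: minus_mem inverse_mem)
      ultimately have "y \<in> ?S" using ksubspace_kspan[of "B - {y}"] unfolding ksubspace_def by metis
      then have "B \<subseteq> ?S" using kspan_superset[of "B - {y}"] by blast
      then have "V \<subseteq> ?S" using kspan_minimal[OF ksubspace_kspan] B(3) by blast
      moreover have "?S \<subseteq> V" using kspan_minimal[OF V] B(2) by blast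
      ultimately have "kspan K (B - {y}) = V" by blast
      then have "card B \<le> card (B - {y})" using least[of "B - {y}"] B(1,2) by (metis Diff_subset order_trans)
      moreover have "card (B - {y}) < card B" using T y by (intro psubset_card_mono) auto
      ultimately show False by simp
    qed
  qed
  with B that show ?thesis by blast
qed

lemma card_ksubspace: "ksubspace K V \<Longrightarrow> card V = card K ^ kdim K V"
  by (metis card_kspan kdim_basis)

lemma card_kspan_krank: "card (kspan K S) = card K ^ krank K S"
  unfolding krank_def by (rule card_ksubspace[OF ksubspace_kspan])

text \<open>Factors a family through a basis of its span. At a node, the \<open>\<beta> j\<close>
  will determine the sub-symbols to send, and \<open>m\<close> will rebuild every check value from
  them.\<close>

lemma krank_coordinates:
  obtains \<beta> m where "\<And>i j. i \<in> I \<Longrightarrow> m i j \<in> K"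
    "\<And>i. i \<in> I \<Longrightarrow> v i = (\<Sum>j<krank K (v ` I). m i j * \<beta> j)"
proof -
  obtain B where B: "card B = krank K (v ` I)" "kspan K B = kspan K (v ` I)"
    unfolding krank_def using kdim_basis[OF ksubspace_kspan] by metis
  obtain \<beta> where \<beta>: "bij_betw \<beta> {..<card B} B"
    using ex_bij_betw_nat_finite[OF finite[of B]] by (auto simp: atLeast0LessThan)
  have "\<exists>c. (\<forall>x\<in>B. c x \<in> K) \<and> v i = (\<Sum>x\<in>B. c x * x)" if "i \<in> I" for i
  proof -
    have "v i \<in> kspan K B" using that kspan_superset[of "v ` I"] B(2) by auto
    then show ?thesis unfolding kspan_eq by blast
  qed
  then obtain c where c: "\<And>i. i \<in> I \<Longrightarrow> (\<forall>x\<in>B. c i x \<in> K) \<and> v i = (\<Sum>x\<in>B. c i x * x)"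
    by metis
  \<comment> \<open>The value 0 beyond the basis puts \<open>m i j\<close> in \<open>K\<close> for
    every \<open>j\<close>, with no bound on the index.\<close>
  define m where "m i j = (if j < card B then c i (\<beta> j) else 0)" for i j
  have "m i j \<in> K" if "i \<in> I" for i j
    using c[OF that] bij_betwE[OF \<beta>] by (auto simp: m_def)
  moreover have "v i = (\<Sum>j<krank K (v ` I). m i j * \<beta> j)" if "i \<in> I" for i
    using c[OF that] by (simp flip: sum.reindex_bij_betw[OF \<beta>] B(1) add: m_def)
  ultimately show ?thesis using that by blast
qed

section \<open>Linear functionals and the pairing that replaces the trace form\<close>

lemma klinear_functional_sum:
  assumes "klinear_functional K \<phi>" "\<And>i. i \<in> I \<Longrightarrow> c i \<in> K"
  shows "\<phi> (\<Sum>i\<in>I. c i * x i) = (\<Sum>i\<in>I. c i * \<phi> (x i))"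
proof -
  have "\<phi> (0 + 0) = \<phi> 0 + \<phi> 0" using assms(1) unfolding klinear_functional_def by blast
  then have "\<phi> 0 = 0" by (metis add_0_right add_left_imp_eq)
  then show ?thesis using assms(2)
    by (induction I rule: infinite_finite_induct)
      (use assms(1) in \<open>auto simp: klinear_functional_def\<close>)
qed

lemma klinear_functional_sum_plain:
  assumes "klinear_functional K \<phi>"
  shows "\<phi> (\<Sum>i\<in>I. x i) = (\<Sum>i\<in>I. \<phi> (x i))"
  using klinear_functional_sum[OF assms, of I "\<lambda>_. 1" x] by simp

lemma klinear_functional_diff:
  assumes "klinear_functional K \<phi>" shows "\<phi> (x - y) = \<phi> x - \<phi> y"
proof -
  have "\<phi> ((x - y) + y) = \<phi> (x - y) + \<phi> y"
    using assms unfolding klinear_functional_def by blast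
  then show ?thesis by simp
qed

lemma klinear_functional_eqI:
  assumes "klinear_functional K \<phi>" "klinear_functional K \<chi>" "kspan K B = UNIV"
    and "\<And>b. b \<in> B \<Longrightarrow> \<phi> b = \<chi> b"
  shows "\<phi> x = \<chi> x"
proof -
  have "x \<in> kspan K B" using assms(3) by simp
  then obtain c where "\<forall>b\<in>B. c b \<in> K" "x = (\<Sum>b\<in>B. c b * b)" unfolding kspan_eq by blast
  then show ?thesis using assms(4)
    by (simp add: klinear_functional_sum[OF assms(1)] klinear_functional_sum[OF assms(2)])
qed

lemma klinear_functional_mult:
  "klinear_functional K \<phi> \<Longrightarrow> klinear_functional K (\<lambda>x. \<phi> (a * x))"
  by (auto simp: klinear_functional_def algebra_simps)

text \<open>The coordinate along one element of a basis of the field is such a functional, with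
  value 1 on that element.\<close>

lemma ex_nonzero_klinear_functional:
  "\<exists>\<psi>. klinear_functional K \<psi> \<and> \<psi> \<noteq> (\<lambda>_. 0)"
proof -
  have "ksubspace K UNIV" by (simp add: ksubspace_def)
  then obtain B where B: "kspan K B = UNIV" "kindep K B" by (metis kdim_basis)
  have "B \<noteq> {}"
  proof
    assume "B = {}"
    then have "(1 :: 'a) \<in> kspan K {}" using B by simp
    then show False by (simp add: kspan_eq)
  qed
  then obtain b where b: "b \<in> B" by blast
  have "\<exists>c. (\<forall>x\<in>B. c x \<in> K) \<and> y = (\<Sum>x\<in>B. c x * x)" for y
  proof -
    have "y \<in> kspan K B" using B by simp
    then show ?thesis unfolding kspan_eq by blast
  qed
  then obtain c where c: "\<And>y. \<forall>x\<in>B. c y x \<in> K" "\<And>y. y = (\<Sum>x\<in>B. c y x * x)" by metis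
  \<comment> \<open>By uniqueness of coordinates, any expansion of \<open>y\<close> over
    \<open>B\<close> may be used to compute \<open>c y b\<close>. Linearity then only needs an
    expansion of each sum and multiple.\<close>
  have coord: "c y b = d b" if "\<forall>x\<in>B. d x \<in> K" "y = (\<Sum>x\<in>B. d x * x)" for y d
    using kindep_coeffs_unique[OF B(2) c(1) that(1) _ b, of y] that(2) c(2)[of y] by simp
  have "klinear_functional K (\<lambda>y. c y b)"
    unfolding klinear_functional_def
  proof (intro conjI allI ballI)
    fix x show "c x b \<in> K" using c b by blast
  next
    fix x y
    have "x + y = (\<Sum>z\<in>B. (c x z + c y z) * z)"
      by (simp add: distrib_right sum.distrib flip: c(2))
    then show "c (x + y) b = c x b + c y b" using c(1) by (intro coord) (auto intro: add_mem)
  next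
    fix a x assume a: "a \<in> K"
    have "a * x = (\<Sum>z\<in>B. (a * c x z) * z)"
      by (simp add: mult.assoc flip: c(2) sum_distrib_left)
    then show "c (a * x) b = a * c x b" using c(1) a by (intro coord) (auto intro: mult_mem)
  qed
  moreover have "c b b = 1"
  proof -
    have "(\<Sum>x\<in>B. (if x = b then 1 else 0) * x) = b"
      using b by (simp add: if_distrib[of "\<lambda>a. a * _"] cong: if_cong)
    then show ?thesis using coord[of "\<lambda>x. if x = b then 1 else 0" b] by simp
  qed
  ultimately show ?thesis by (metis zero_neq_one)
qed

text \<open>For \<open>x \<noteq> 0\<close> the products \<open>y * x\<close> run through the whole
  field, so \<open>\<psi>\<close> would vanish identically.\<close>

lemma klinear_functional_nondegenerate:
  assumes "klinear_functional K \<psi>" "\<psi> \<noteq> (\<lambda>_. 0)" "\<And>y. \<psi> (y * x) = 0"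
  shows "x = 0"
proof (rule ccontr)
  assume "x \<noteq> 0"
  then have "\<psi> z = 0" for z using assms(3)[of "z / x"] by simp
  then show False using assms(2) by blast
qed

text \<open>Agreement on a spanning set extends linearly to all multipliers, and nondegeneracy then
  applies to \<open>x - y\<close>.\<close>

lemma klinear_functional_basis_unique:
  assumes \<psi>: "klinear_functional K \<psi>" "\<psi> \<noteq> (\<lambda>_. 0)" and B: "kspan K B = UNIV"
    and eq: "\<And>b. b \<in> B \<Longrightarrow> \<psi> (b * x) = \<psi> (b * y)"
  shows "x = y"
proof -
  have "\<psi> (x * z) = \<psi> (y * z)" for z
    by (rule klinear_functional_eqI[OF klinear_functional_mult[OF \<psi>(1), of x]
          klinear_functional_mult[OF \<psi>(1), of y] B]) (use eq in \<open>simp add: mult.commute\<close>)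
  then have "\<psi> (z * (x - y)) = 0" for z
    by (metis right_diff_distrib klinear_functional_diff[OF \<psi>(1)] mult.commute right_minus_eq)
  then have "x - y = 0" using klinear_functional_nondegenerate[OF \<psi>] by blast
  then show ?thesis by simp
qed

text \<open>Counting replaces the construction of a dual basis: sending \<open>x\<close> to the
  family of all \<open>\<psi> (b * x)\<close> is injective into
  \<open>B \<rightarrow>\<^sub>E K\<close>, which has as many elements as the field, hence
  surjective.\<close>

lemma ex_dual_element:
  assumes \<psi>: "klinear_functional K \<psi>" "\<psi> \<noteq> (\<lambda>_. 0)"
    and B: "kindep K B" "kspan K B = UNIV"
    and v: "\<forall>b\<in>B. v b \<in> K"
  shows "\<exists>x. \<forall>b\<in>B. \<psi> (b * x) = v b"
proof -
  let ?f = "\<lambda>x. restrict (\<lambda>b. \<psi> (b * x)) B"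
  have "inj ?f"
  proof (rule injI)
    fix x y assume "?f x = ?f y"
    from fun_cong[OF this] have "\<psi> (b * x) = \<psi> (b * y)" if "b \<in> B" for b
      using that by (metis restrict_apply')
    then show "x = y" by (rule klinear_functional_basis_unique[OF \<psi> B(2)])
  qed
  then have "card (range ?f) = card (B \<rightarrow>\<^sub>E K)"
    using card_kspan[OF B(1)] B(2) by (simp add: card_image card_PiE)
  moreover have "range ?f \<subseteq> B \<rightarrow>\<^sub>E K" using \<psi>(1) by (auto simp: klinear_functional_def)
  ultimately have "range ?f = B \<rightarrow>\<^sub>E K" by (intro card_subset_eq) (auto intro: finite_PiE)
  moreover have "restrict v B \<in> B \<rightarrow>\<^sub>E K" using v by auto
  ultimately obtain x where x: "restrict v B = ?f x" by blast
  have "\<psi> (b * x) = v b" if "b \<in> B" for b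
    using fun_cong[OF x, of b] that by simp
  then show ?thesis by blast
qed

text \<open>A functional is fixed by its values on a basis, and \<open>ex_dual_element\<close>
  provides a \<open>\<delta>\<close> producing exactly these values.\<close>

lemma klinear_functional_representation:
  assumes \<psi>: "klinear_functional K \<psi>" "\<psi> \<noteq> (\<lambda>_. 0)" and Q: "klinear_functional K Q"
  shows "\<exists>\<delta>. \<forall>x. Q x = \<psi> (\<delta> * x)"
proof -
  have "ksubspace K UNIV" by (simp add: ksubspace_def)
  then obtain B where B: "kspan K B = UNIV" "kindep K B" by (metis kdim_basis)
  have "\<forall>b\<in>B. Q b \<in> K" using Q by (auto simp: klinear_functional_def)
  from ex_dual_element[OF \<psi> B(2,1) this] obtain \<delta> where \<delta>: "\<forall>b\<in>B. \<psi> (b * \<delta>) = Q b" by blast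
  have "Q x = \<psi> (\<delta> * x)" for x
    by (rule klinear_functional_eqI[OF Q klinear_functional_mult[OF \<psi>(1)] B(1)])
      (use \<delta> in \<open>simp add: mult.commute\<close>)
  then show ?thesis by blast
qed

end

section \<open>Lagrange multipliers and subspace polynomials\<close>

lemma degree_prod_monic_linear: "finite A \<Longrightarrow> degree (\<Prod>a\<in>A. [:- a, 1:] :: 'a::field poly) = card A"
  by (subst degree_prod_eq_sum_degree) auto

lemma coeff_prod_monic_linear: "finite A \<Longrightarrow> coeff (\<Prod>a\<in>A. [:- a, 1:] :: 'a::field poly) (card A) = 1"
  using lead_coeff_prod[of "\<lambda>a. [:- a, 1:]" A] by (simp add: degree_prod_monic_linear)

lemma poly_subspace_poly: "poly (subspace_poly W) x = (\<Prod>w\<in>W. x - w)"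
  by (simp add: subspace_poly_def poly_prod)

lemma subspace_poly_eq_0_iff: "finite W \<Longrightarrow> poly (subspace_poly W) x = 0 \<longleftrightarrow> x \<in> W"
  by (auto simp: poly_subspace_poly)

text \<open>The sum is the coefficient of degree \<open>card A - 1\<close> in the Lagrange
  interpolant of \<open>p\<close> on \<open>A\<close>. That interpolant is \<open>p\<close> itself,
  whose degree is smaller. The \<open>\<mu> \<alpha>\<close> serve as the multipliers in the check
  equations.\<close>

lemma ex_lagrange_multipliers:
  fixes A :: "'a::field set"
  assumes A: "finite A"
  obtains \<mu> where "\<And>\<alpha>. \<alpha> \<in> A \<Longrightarrow> \<mu> \<alpha> \<noteq> 0"
    "\<And>p. degree p < card A - 1 \<Longrightarrow> (\<Sum>\<alpha>\<in>A. \<mu> \<alpha> * poly p \<alpha>) = 0"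
proof
  define \<mu> where "\<mu> \<alpha> = inverse (\<Prod>\<beta>\<in>A - {\<alpha>}. \<alpha> - \<beta>)" for \<alpha>
  show nz: "\<mu> \<alpha> \<noteq> 0" if "\<alpha> \<in> A" for \<alpha> using A that by (simp add: \<mu>_def)
  fix p :: "'a poly" assume deg: "degree p < card A - 1"
  define L where "L \<alpha> = (\<Prod>\<beta>\<in>A - {\<alpha>}. [:- \<beta>, 1:])" for \<alpha>
  define Q where "Q = (\<Sum>\<alpha>\<in>A. smult (\<mu> \<alpha> * poly p \<alpha>) (L \<alpha>))"
  have deg_L: "degree (L \<alpha>) = card A - 1" and coeff_L: "coeff (L \<alpha>) (card A - 1) = 1"
    if "\<alpha> \<in> A" for \<alpha>
    using A that degree_prod_monic_linear[of "A - {\<alpha>}"] coeff_prod_monic_linear[of "A - {\<alpha>}"]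
    by (simp_all add: L_def)
  have "degree Q \<le> card A - 1"
    unfolding Q_def using deg_L by (intro degree_sum_le A) (metis degree_smult_le)
  moreover have "poly p x = poly Q x" if x: "x \<in> A" for x
  proof -
    have "poly (L \<alpha>) x = (if \<alpha> = x then inverse (\<mu> x) else 0)" if "\<alpha> \<in> A" for \<alpha>
      using A x that by (auto simp: L_def \<mu>_def poly_prod)
    then have "poly Q x = (\<Sum>\<alpha>\<in>A. if \<alpha> = x then poly p x else 0)"
      unfolding Q_def poly_sum using nz by (intro sum.cong) auto
    then show ?thesis using A x by simp
  qed
  ultimately have "p = Q"
    using deg by (intro poly_eqI_degree[of A]) auto
  then have "coeff Q (card A - 1) = 0" using deg coeff_eq_0 by blast
  moreover have "coeff Q (card A - 1) = (\<Sum>\<alpha>\<in>A. \<mu> \<alpha> * poly p \<alpha>)"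
    unfolding Q_def coeff_sum using coeff_L by (intro sum.cong) auto
  ultimately show "(\<Sum>\<alpha>\<in>A. \<mu> \<alpha> * poly p \<alpha>) = 0" by simp
qed

text \<open>After the substitution the factor for \<open>w = 0\<close> is \<open>u\<close> times
  \<open>[:- a, 1:]\<close>, so the division is exact. The product form gives degree and values
  directly.\<close>

lemma check_poly_eq:
  fixes W :: "'a::{finite,field} set"
  assumes "0 \<in> W"
  shows "check_poly W u a = smult u (\<Prod>w\<in>W - {0}. [:- (u * a) - w, u:])"
proof -
  have "pcompose (subspace_poly W) [:- (u * a), u:] = (\<Prod>w\<in>W. [:- (u * a) - w, u:])"
    by (simp add: subspace_poly_def pcompose_prod pcompose_pCons minus_diff_commute)
  also have "\<dots> = [:- (u * a), u:] * (\<Prod>w\<in>W - {0}. [:- (u * a) - w, u:])"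
    using assms by (simp add: prod.remove)
  also have "\<dots> = smult u (\<Prod>w\<in>W - {0}. [:- (u * a) - w, u:]) * [:- a, 1:]"
  proof -
    have "[:- (u * a), u:] = smult u [:- a, 1:]" by simp
    then show ?thesis
      by (simp only: mult_smult_left mult_smult_right mult.commute[of _ "[:- a, 1:]"])
  qed
  finally show ?thesis
    unfolding check_poly_def by (simp only:) (rule nonzero_mult_div_cancel_right, simp)
qed

lemma degree_check_poly:
  fixes W :: "'a::{finite,field} set"
  assumes "0 \<in> W" "u \<noteq> 0"
  shows "degree (check_poly W u a) = card W - 1"
  using assms by (simp add: check_poly_eq degree_prod_eq_sum_degree)

text \<open>The factor beside \<open>u\<close> is nonzero and independent of \<open>u\<close>, so
  the checks built from a basis again take basis values at the failed node.\<close>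

lemma poly_check_poly_center:
  fixes W :: "'a::{finite,field} set"
  assumes "0 \<in> W"
  shows "poly (check_poly W u a) a = u * (\<Prod>w\<in>W - {0}. - w)"
  using assms by (simp add: check_poly_eq poly_prod algebra_simps)

lemma poly_check_poly:
  fixes W :: "'a::{finite,field} set"
  assumes "0 \<in> W" "x \<noteq> a"
  shows "poly (check_poly W u a) x = poly (subspace_poly W) (u * (x - a)) / (x - a)"
proof -
  have "poly (subspace_poly W) (u * (x - a)) = u * (x - a) * (\<Prod>w\<in>W - {0}. u * (x - a) - w)"
    using assms(1) by (simp add: poly_subspace_poly prod.remove)
  moreover have "(\<Prod>w\<in>W - {0}. u * (x - a) - w) = (\<Prod>w\<in>W - {0}. - (u * a) - w + x * u)"
    by (intro prod.cong) (auto simp: algebra_simps)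
  ultimately show ?thesis using assms by (simp add: check_poly_eq poly_prod)
qed

section \<open>Linearity of subspace polynomials and the rank of the check values\<close>

context finite_subfield
begin

lemma ksubspace_diff:
  assumes "ksubspace K W" "x \<in> W" "y \<in> W" shows "x - y \<in> W"
proof -
  have "- 1 * y \<in> W" using assms minus_mem[OF one_mem] unfolding ksubspace_def by blast
  then have "x + (- 1 * y) \<in> W" using assms unfolding ksubspace_def by blast
  then show ?thesis by simp
qed

text \<open>Translation by \<open>w\<close> permutes \<open>W\<close>, hence the linear
  factors.\<close>

lemma poly_subspace_poly_translate:
  assumes W: "ksubspace K W" and w: "w \<in> W"
  shows "poly (subspace_poly W) (w + x) = poly (subspace_poly W) x"
proof -
  have "bij_betw ((+) w) W W"
    using assms by (intro bij_betwI[where g = "\<lambda>x. x - w"])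
      (auto simp: ksubspace_def ksubspace_diff)
  then have "(\<Prod>v\<in>W. w + x - (w + v)) = (\<Prod>v\<in>W. w + x - v)"
    by (rule prod.reindex_bij_betw)
  then show ?thesis by (simp add: poly_subspace_poly)
qed

text \<open>Both sides are monic in \<open>x\<close> of degree \<open>card W\<close> and agree on \<open>W\<close>.\<close>
lemma poly_subspace_poly_add:
  assumes W: "ksubspace K W"
  shows "poly (subspace_poly W) (x + y) = poly (subspace_poly W) x + poly (subspace_poly W) y"
proof -
  let ?L = "subspace_poly W"
  let ?p = "pcompose ?L [:y, 1:]" and ?q = "?L + [:poly ?L y:]"
  have p: "?p = (\<Prod>w\<in>W. [:y - w, 1:])"
    by (simp add: subspace_poly_def pcompose_prod pcompose_pCons)
  have deg_p: "degree ?p = card W" unfolding p by (subst degree_prod_eq_sum_degree) auto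
  have lc_p: "coeff ?p (card W) = 1"
    using lead_coeff_prod[of "\<lambda>w. [:y - w, 1:]" W] deg_p unfolding p by simp
  have "0 \<in> W" using W by (simp add: ksubspace_def)
  \<comment> \<open>Positive degree keeps the constant added in \<open>?q\<close> away from the
    leading coefficient.\<close>
  then have "card W > 0" by (auto simp: card_gt_0_iff)
  moreover have "degree ?L = card W" "coeff ?L (card W) = 1"
    by (simp_all add: subspace_poly_def degree_prod_monic_linear coeff_prod_monic_linear)
  ultimately have q: "degree ?q \<le> card W" "coeff ?q (card W) = 1"
    by (auto intro: degree_add_le simp: coeff_pCons split: nat.splits)
  have "?p = ?q"
  proof (rule poly_eqI_degree_lead_coeff[of _ "card W" _ W])
    fix w assume "w \<in> W"
    then show "poly ?p w = poly ?q w"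
      using poly_subspace_poly_translate[OF W, of w y]
      by (simp add: poly_pcompose subspace_poly_eq_0_iff add.commute)
  qed (use q deg_p lc_p in auto)
  then have "poly ?p x = poly ?q x" by simp
  then show ?thesis by (simp add: poly_pcompose add.commute)
qed

text \<open>Pulling a nonzero \<open>a\<close> out of every factor yields \<open>a ^ card W\<close>,
  which equals \<open>a\<close> because \<open>card W\<close> is a power of
  \<open>card K\<close>.\<close>

lemma poly_subspace_poly_scale:
  assumes W: "ksubspace K W" and a: "a \<in> K"
  shows "poly (subspace_poly W) (a * x) = a * poly (subspace_poly W) x"
proof (cases "a = 0")
  case True
  then show ?thesis using W by (simp add: subspace_poly_eq_0_iff ksubspace_def)
next
  case False
  have "bij_betw ((*) a) W W"
    using W a False by (intro bij_betwI[where g = "(*) (inverse a)"])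
      (auto simp: ksubspace_def inverse_mem)
  then have "(\<Prod>w\<in>W. a * x - a * w) = (\<Prod>w\<in>W. a * x - w)"
    by (rule prod.reindex_bij_betw)
  moreover have "(\<Prod>w\<in>W. a * x - a * w) = a ^ card W * (\<Prod>w\<in>W. x - w)"
    by (simp add: prod.distrib flip: right_diff_distrib)
  ultimately show ?thesis
    by (simp add: poly_subspace_poly card_ksubspace[OF W] power_card_power_eq[OF a])
qed

text \<open>Rank-nullity by counting: every nonempty fibre is a coset of the kernel
  \<open>W\<close>.\<close>

lemma card_range_subspace_poly:
  assumes W: "ksubspace K W"
  shows "card (range (poly (subspace_poly W))) * card W = card (UNIV :: 'a set)"
proof -
  let ?L = "poly (subspace_poly W)"
  have "card {x. ?L x = y} = card W" if "y \<in> range ?L" for y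
  proof -
    obtain z where z: "y = ?L z" using \<open>y \<in> range ?L\<close> by blast
    have "{x. ?L x = y} = (\<lambda>w. w + z) ` W"
    proof (intro equalityI subsetI)
      fix x assume "x \<in> {x. ?L x = y}"
      then have "?L (x - z) = 0"
        using poly_subspace_poly_add[OF W, of "x - z" z] z by simp
      then have "x - z \<in> W" by (simp add: subspace_poly_eq_0_iff)
      then show "x \<in> (\<lambda>w. w + z) ` W" by (intro image_eqI[of _ _ "x - z"]) auto
    qed (use poly_subspace_poly_translate[OF W] z in auto)
    then show ?thesis by (simp add: card_image)
  qed
  moreover have "card (UNIV :: 'a set) = (\<Sum>y\<in>range ?L. card {x. ?L x = y})"
    using sum.image_gen[of "UNIV :: 'a set" "\<lambda>_. 1 :: nat" ?L] by simp
  ultimately show ?thesis by simp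
qed

text \<open>All check values at \<open>x\<close> lie in the image of the subspace polynomial divided
  by \<open>x - a\<close>, a \<open>K\<close>-subspace whose size times \<open>card W\<close> is the
  size of the field. In exponents this says that the rank is at most \<open>t - s\<close>.\<close>

lemma krank_check_poly_values:
  assumes W: "ksubspace K W" and "x \<noteq> a"
  shows "card K ^ krank K ((\<lambda>i. poly (check_poly W (u i) a) x) ` I) * card W \<le> card (UNIV :: 'a set)"
proof -
  let ?L = "poly (subspace_poly W)"
  let ?g = "\<lambda>y. ?L (y * (x - a)) / (x - a)"
  have "0 \<in> W" using W by (simp add: ksubspace_def)
  have "ksubspace K (range ?g)"
    unfolding ksubspace_def
  proof (safe)
    show "0 \<in> range ?g" using \<open>0 \<in> W\<close> by (intro image_eqI[of _ _ 0]) (auto simp: subspace_poly_eq_0_iff)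
  next
    fix y z show "?g y + ?g z \<in> range ?g"
      by (intro image_eqI[of _ _ "y + z"])
        (auto simp: poly_subspace_poly_add[OF W] distrib_right add_divide_distrib)
  next
    fix c y assume "c \<in> K" then show "c * ?g y \<in> range ?g"
      by (intro image_eqI[of _ _ "c * y"]) (auto simp: poly_subspace_poly_scale[OF W] mult.assoc)
  qed
  moreover have "(\<lambda>i. poly (check_poly W (u i) a) x) ` I \<subseteq> range ?g"
    using poly_check_poly[OF \<open>0 \<in> W\<close> \<open>x \<noteq> a\<close>] by auto
  ultimately have "kspan K ((\<lambda>i. poly (check_poly W (u i) a) x) ` I) \<subseteq> range ?g"
    by (rule kspan_minimal)
  also have "range ?g \<subseteq> (\<lambda>y. y / (x - a)) ` range ?L" by auto
  finally have "card (kspan K ((\<lambda>i. poly (check_poly W (u i) a) x) ` I)) \<le> card (range ?L)"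
    by (meson card_image_le card_mono finite le_trans)
  then show ?thesis
    using card_range_subspace_poly[OF W] by (metis card_kspan_krank mult_le_mono1)
qed

end

section \<open>Repair from checks\<close>

context finite_subfield
begin

text \<open>Node \<open>\<alpha>\<close> sends
  \<open>\<psi> (\<mu> \<alpha> * \<beta> \<alpha> j * c \<alpha>)\<close> for a basis
  \<open>\<beta> \<alpha>\<close> of the span of its check values. Their
  \<open>K\<close>-combinations give \<open>\<psi>\<close> of each term of a check, and the check
  equation then yields \<open>\<psi> (g i \<alpha>s * (\<mu> \<alpha>s * c \<alpha>s))\<close> for
  all \<open>i\<close>, which determines \<open>c \<alpha>s\<close>.\<close>

lemma linear_repair_scheme_of_checks:
  assumes \<alpha>s: "\<alpha>s \<in> A" and \<mu>: "\<mu> \<alpha>s \<noteq> 0"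
    and checks: "\<And>i c. i \<in> I \<Longrightarrow> c \<in> C \<Longrightarrow> (\<Sum>\<alpha>\<in>A. \<mu> \<alpha> * g i \<alpha> * c \<alpha>) = 0"
    and inj: "inj_on (\<lambda>i. g i \<alpha>s) I"
    and indep: "kindep K ((\<lambda>i. g i \<alpha>s) ` I)"
    and span: "kspan K ((\<lambda>i. g i \<alpha>s) ` I) = UNIV"
  shows "linear_repair_scheme K A C \<alpha>s (\<lambda>\<alpha>. krank K ((\<lambda>i. g i \<alpha>) ` I))"
proof -
  obtain \<psi> where \<psi>: "klinear_functional K \<psi>" "\<psi> \<noteq> (\<lambda>_. 0)"
    using ex_nonzero_klinear_functional by blast
  define b where "b \<alpha> = krank K ((\<lambda>i. g i \<alpha>) ` I)" for \<alpha>
  have "\<exists>\<beta> m. \<forall>i\<in>I. (\<forall>j. m i j \<in> K) \<and> g i \<alpha> = (\<Sum>j<b \<alpha>. m i j * \<beta> j)" for \<alpha>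
    using krank_coordinates[of I "\<lambda>i. g i \<alpha>"] unfolding b_def by metis
  then obtain \<beta> m where \<beta>m:
    "\<And>\<alpha>. \<forall>i\<in>I. (\<forall>j. m \<alpha> i j \<in> K) \<and> g i \<alpha> = (\<Sum>j<b \<alpha>. m \<alpha> i j * \<beta> \<alpha> j)"
    by metis
  then have m: "m \<alpha> i j \<in> K" and g: "g i \<alpha> = (\<Sum>j<b \<alpha>. m \<alpha> i j * \<beta> \<alpha> j)" if "i \<in> I" for i j \<alpha>
    using that by blast+
  define v where "v d i = - (\<Sum>\<alpha>\<in>A - {\<alpha>s}. \<Sum>j<b \<alpha>. m \<alpha> i j * d \<alpha> j)" for d i
  \<comment> \<open>The element with the prescribed values \<open>v d i\<close> under the pairing is
    picked by choice; existence comes from \<open>R_eq\<close> and uniqueness from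
    \<open>R_unique\<close>.\<close>
  define R where "R d = (SOME y. \<forall>i\<in>I. \<psi> (g i \<alpha>s * y) = v d i) / \<mu> \<alpha>s" for d
  define Q where "Q \<alpha> j x = \<psi> (\<mu> \<alpha> * \<beta> \<alpha> j * x)" for \<alpha> j x
  let ?D = "download_space K A \<alpha>s b"
  have R_eq: "\<forall>i\<in>I. \<psi> (g i \<alpha>s * (\<mu> \<alpha>s * R d)) = v d i" if "d \<in> ?D" for d
  proof -
    have "v d i \<in> K" if "i \<in> I" for i
      unfolding v_def using \<open>d \<in> ?D\<close> m[OF that]
      by (intro minus_mem sum_mem mult_mem) (auto simp: download_space_def)
    \<comment> \<open>\<open>ex_dual_element\<close> indexes its targets by basis elements, so the
      index \<open>i\<close> is recovered through the inverse of
      \<open>i \<mapsto> g i \<alpha>s\<close>.\<close>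
    then have "\<forall>x\<in>(\<lambda>i. g i \<alpha>s) ` I. v d (the_inv_into I (\<lambda>i. g i \<alpha>s) x) \<in> K"
      by (auto simp: the_inv_into_f_f[OF inj])
    from ex_dual_element[OF \<psi> indep span this] have "\<exists>y. \<forall>i\<in>I. \<psi> (g i \<alpha>s * y) = v d i"
      by (auto simp: the_inv_into_f_f[OF inj])
    from someI_ex[OF this] show ?thesis using \<mu> by (simp add: R_def)
  qed
  \<comment> \<open>Additivity, homogeneity and correctness of \<open>R\<close> are all proved by
    verifying this characterization for the expected result.\<close>
  have R_unique: "R d = y" if "d \<in> ?D" "\<And>i. i \<in> I \<Longrightarrow> \<psi> (g i \<alpha>s * (\<mu> \<alpha>s * y)) = v d i" for d y
  proof -
    have "\<mu> \<alpha>s * R d = \<mu> \<alpha>s * y"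
      by (rule klinear_functional_basis_unique[OF \<psi> span]) (use R_eq[OF that(1)] that(2) in auto)
    then show ?thesis using \<mu> by simp
  qed
  have "linear_repair_scheme K A C \<alpha>s b"
    unfolding linear_repair_scheme_def
  proof (intro exI[of _ Q] exI[of _ R] conjI ballI allI impI)
    fix \<alpha> j show "klinear_functional K (Q \<alpha> j)"
      unfolding Q_def by (rule klinear_functional_mult[OF \<psi>(1)])
  next
    fix d e assume de: "d \<in> ?D" "e \<in> ?D"
    show "R (\<lambda>\<alpha> j. d \<alpha> j + e \<alpha> j) = R d + R e"
    proof (rule R_unique)
      show "(\<lambda>\<alpha> j. d \<alpha> j + e \<alpha> j) \<in> ?D" using de by (auto simp: download_space_def add_mem)
      fix i assume i: "i \<in> I"
      have "\<psi> (g i \<alpha>s * (\<mu> \<alpha>s * (R d + R e))) =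
          \<psi> (g i \<alpha>s * (\<mu> \<alpha>s * R d)) + \<psi> (g i \<alpha>s * (\<mu> \<alpha>s * R e))"
        using \<psi>(1) unfolding klinear_functional_def distrib_left by blast
      then show "\<psi> (g i \<alpha>s * (\<mu> \<alpha>s * (R d + R e))) = v (\<lambda>\<alpha> j. d \<alpha> j + e \<alpha> j) i"
        using R_eq de i by (simp add: v_def distrib_left sum.distrib)
    qed
  next
    fix a d assume ad: "a \<in> K" "d \<in> ?D"
    show "R (\<lambda>\<alpha> j. a * d \<alpha> j) = a * R d"
    proof (rule R_unique)
      show "(\<lambda>\<alpha> j. a * d \<alpha> j) \<in> ?D" using ad by (auto simp: download_space_def mult_mem)
      fix i assume i: "i \<in> I"
      have "\<psi> (a * (g i \<alpha>s * (\<mu> \<alpha>s * R d))) = a * \<psi> (g i \<alpha>s * (\<mu> \<alpha>s * R d))"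
        using \<psi>(1) ad(1) unfolding klinear_functional_def by blast
      then have "\<psi> (g i \<alpha>s * (\<mu> \<alpha>s * (a * R d))) = a * v d i"
        using R_eq[OF ad(2)] i by (simp add: mult.left_commute)
      then show "\<psi> (g i \<alpha>s * (\<mu> \<alpha>s * (a * R d))) = v (\<lambda>\<alpha> j. a * d \<alpha> j) i"
        by (simp add: v_def sum_distrib_left mult.left_commute)
    qed
  next
    fix c assume c: "c \<in> C"
    let ?d = "download A \<alpha>s b Q c"
    show "R ?d = c \<alpha>s"
    proof (rule R_unique)
      show "?d \<in> ?D"
        using \<psi>(1) by (auto simp: download_space_def download_def Q_def klinear_functional_def)
      fix i assume i: "i \<in> I"
      have "\<psi> (\<mu> \<alpha> * g i \<alpha> * c \<alpha>) = (\<Sum>j<b \<alpha>. m \<alpha> i j * ?d \<alpha> j)" if "\<alpha> \<in> A - {\<alpha>s}" for \<alpha>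
      proof -
        have "\<mu> \<alpha> * g i \<alpha> * c \<alpha> = (\<Sum>j<b \<alpha>. m \<alpha> i j * (\<mu> \<alpha> * \<beta> \<alpha> j * c \<alpha>))"
          by (simp add: g[OF i] sum_distrib_left sum_distrib_right mult_ac)
        then have "\<psi> (\<mu> \<alpha> * g i \<alpha> * c \<alpha>) = (\<Sum>j<b \<alpha>. m \<alpha> i j * \<psi> (\<mu> \<alpha> * \<beta> \<alpha> j * c \<alpha>))"
          using m[OF i] by (simp add: klinear_functional_sum[OF \<psi>(1)])
        then show ?thesis using that by (simp add: download_def Q_def)
      qed
      moreover have "g i \<alpha>s * (\<mu> \<alpha>s * c \<alpha>s) = 0 - (\<Sum>\<alpha>\<in>A - {\<alpha>s}. \<mu> \<alpha> * g i \<alpha> * c \<alpha>)"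
        using checks[OF i c] \<alpha>s by (simp add: sum.remove eq_neg_iff_add_eq_0 mult_ac)
      moreover have "\<psi> 0 = 0"
        using klinear_functional_diff[OF \<psi>(1), of 0 0] by simp
      ultimately show "\<psi> (g i \<alpha>s * (\<mu> \<alpha>s * c \<alpha>s)) = v ?d i"
        by (simp only: klinear_functional_diff[OF \<psi>(1)] klinear_functional_sum_plain[OF \<psi>(1)] v_def)
          simp
    qed
  qed
  then show ?thesis by (simp add: b_def [abs_def])
qed

end

section \<open>Lower bound on the bandwidth\<close>

text \<open>Closure under scalars of the whole field, not only of \<open>K\<close>, later lifts an
  identity under \<open>\<psi>\<close> to an identity in the field.\<close>

lemma RS_scale: "c \<in> RS A k \<Longrightarrow> (\<lambda>\<alpha>. x * c \<alpha>) \<in> RS A k"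
proof -
  assume "c \<in> RS A k"
  then obtain f where "f = 0 \<or> degree f < k" "\<forall>\<alpha>\<in>A. c \<alpha> = poly f \<alpha>" "\<forall>\<alpha>. \<alpha> \<notin> A \<longrightarrow> c \<alpha> = 0"
    unfolding RS_def by blast
  then show ?thesis unfolding RS_def
    by (auto intro!: exI[of _ "smult x f"] le_less_trans[OF degree_smult_le])
qed

text \<open>If the support had at most \<open>k\<close> points, the polynomial vanishing on it
  except at \<open>a\<close> would have degree below \<open>k\<close>, and its codeword would pair
  with \<open>h\<close> to a nonzero value.\<close>

lemma RS_dual_weight:
  fixes A :: "'a::field set"
  assumes A: "finite A" and dual: "\<And>c. c \<in> RS A k \<Longrightarrow> (\<Sum>\<alpha>\<in>A. h \<alpha> * c \<alpha>) = 0"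
    and a: "a \<in> A" "h a \<noteq> 0"
  shows "k < card {\<alpha> \<in> A. h \<alpha> \<noteq> 0}"
proof (rule ccontr)
  let ?S = "{\<alpha> \<in> A. h \<alpha> \<noteq> 0}"
  let ?f = "\<Prod>\<beta>\<in>?S - {a}. [:- \<beta>, 1:]"
  let ?c = "\<lambda>\<alpha>. if \<alpha> \<in> A then poly ?f \<alpha> else 0"
  assume "\<not> k < card ?S"
  moreover have "card (?S - {a}) < card ?S" using A a by (intro psubset_card_mono) auto
  moreover have "degree ?f = card (?S - {a})"
    using A by (subst degree_prod_eq_sum_degree) auto
  ultimately have "?c \<in> RS A k" unfolding RS_def by (auto intro!: exI[of _ ?f])
  from dual[OF this] have "(\<Sum>\<alpha>\<in>A. h \<alpha> * poly ?f \<alpha>) = 0" by simp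
  moreover have "h \<alpha> * poly ?f \<alpha> = 0" if "\<alpha> \<in> A - {a}" for \<alpha>
    using A that by (auto simp: poly_prod)
  ultimately have "h a * poly ?f a = 0" using A a by (simp add: sum.remove)
  then show False using A a by (auto simp: poly_prod)
qed

section \<open>From a repair scheme to dual words, and counting their zeros\<close>

context finite_subfield
begin

text \<open>The recovery map is linear on downloads, hence given by its values
  \<open>\<rho> \<alpha> j\<close> on unit downloads.\<close>

lemma linear_repair_schemeE:
  assumes "linear_repair_scheme K A C \<alpha>s b"
  obtains Q \<rho> where "\<And>\<alpha> j. \<alpha> \<in> A - {\<alpha>s} \<Longrightarrow> j < b \<alpha> \<Longrightarrow> klinear_functional K (Q \<alpha> j)"
    "\<And>c. c \<in> C \<Longrightarrow> c \<alpha>s = (\<Sum>\<alpha>\<in>A - {\<alpha>s}. \<Sum>j<b \<alpha>. Q \<alpha> j (c \<alpha>) * \<rho> \<alpha> j)"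
proof -
  let ?D = "download_space K A \<alpha>s b"
  obtain Q R where Q: "\<And>\<alpha> j. \<alpha> \<in> A - {\<alpha>s} \<Longrightarrow> j < b \<alpha> \<Longrightarrow> klinear_functional K (Q \<alpha> j)"
    and add: "\<And>d e. d \<in> ?D \<Longrightarrow> e \<in> ?D \<Longrightarrow> R (\<lambda>\<alpha> j. d \<alpha> j + e \<alpha> j) = R d + R e"
    and scale: "\<And>a d. a \<in> K \<Longrightarrow> d \<in> ?D \<Longrightarrow> R (\<lambda>\<alpha> j. a * d \<alpha> j) = a * R d"
    and repair: "\<And>c. c \<in> C \<Longrightarrow> R (download A \<alpha>s b Q c) = c \<alpha>s"
    using assms unfolding linear_repair_scheme_def by blast
  define P where "P = Sigma (A - {\<alpha>s}) (\<lambda>\<alpha>. {..<b \<alpha>})"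
  define e where "e p = (\<lambda>\<alpha> j. if (\<alpha>, j) = p then 1 else 0 :: 'a)" for p :: "'a \<times> nat"
  have e: "e p \<in> ?D" if "p \<in> P" for p
    using that by (auto simp: e_def P_def download_space_def)
  \<comment> \<open>Linearity of \<open>R\<close> is known only on \<open>?D\<close>, so
    \<open>d\<close> is assembled coordinate by coordinate while staying inside this set.\<close>
  have R_restrict: "R (\<lambda>\<alpha> j. if (\<alpha>, j) \<in> S then d \<alpha> j else 0) = (\<Sum>(\<alpha>, j)\<in>S. d \<alpha> j * R (e (\<alpha>, j)))"
    if d: "d \<in> ?D" and "finite S" "S \<subseteq> P" for d S
    using that(2,3)
  proof (induction S rule: finite_induct)
    case empty
    have "R (\<lambda>\<alpha> j. 0 * d \<alpha> j) = 0 * R d" by (rule scale[OF zero_mem d])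
    then show ?case by simp
  next
    case (insert p S)
    obtain \<alpha> j where p: "p = (\<alpha>, j)" by force
    have dp: "d \<alpha> j \<in> K" using d by (auto simp: download_space_def)
    let ?r = "\<lambda>\<alpha> j. if (\<alpha>, j) \<in> S then d \<alpha> j else 0" and ?s = "\<lambda>\<alpha>' j'. d \<alpha> j * e p \<alpha>' j'"
    have "?r \<in> ?D" using d by (auto simp: download_space_def)
    moreover have "?s \<in> ?D" using e[of p] insert.prems dp by (auto simp: download_space_def mult_mem)
    ultimately have "R (\<lambda>\<alpha>' j'. ?r \<alpha>' j' + ?s \<alpha>' j') = R ?r + R ?s" by (rule add)
    moreover have "(\<lambda>\<alpha>' j'. ?r \<alpha>' j' + ?s \<alpha>' j') =
        (\<lambda>\<alpha> j. if (\<alpha>, j) \<in> insert p S then d \<alpha> j else 0)"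
      using insert.hyps by (intro ext) (auto simp: p e_def)
    moreover have "R ?s = d \<alpha> j * R (e p)" using scale[OF dp e] insert.prems by auto
    ultimately show ?case using insert by (simp add: p)
  qed
  have R_eq: "R d = (\<Sum>(\<alpha>, j)\<in>P. d \<alpha> j * R (e (\<alpha>, j)))" if d: "d \<in> ?D" for d
  proof -
    have "(\<lambda>\<alpha> j. if (\<alpha>, j) \<in> P then d \<alpha> j else 0) = d"
      using d by (intro ext) (auto simp: download_space_def P_def)
    moreover have "finite P" by (auto simp: P_def)
    ultimately show ?thesis
      using R_restrict[OF d, of P] by simp
  qed
  have "c \<alpha>s = (\<Sum>\<alpha>\<in>A - {\<alpha>s}. \<Sum>j<b \<alpha>. Q \<alpha> j (c \<alpha>) * R (e (\<alpha>, j)))" if c: "c \<in> C" for c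
  proof -
    let ?d = "download A \<alpha>s b Q c"
    have "?d \<in> ?D" using Q by (auto simp: download_space_def download_def klinear_functional_def)
    then have "c \<alpha>s = (\<Sum>(\<alpha>, j)\<in>P. ?d \<alpha> j * R (e (\<alpha>, j)))" using R_eq repair[OF c] by simp
    also have "\<dots> = (\<Sum>\<alpha>\<in>A - {\<alpha>s}. \<Sum>j<b \<alpha>. ?d \<alpha> j * R (e (\<alpha>, j)))"
      unfolding P_def by (subst sum.Sigma) auto
    also have "\<dots> = (\<Sum>\<alpha>\<in>A - {\<alpha>s}. \<Sum>j<b \<alpha>. Q \<alpha> j (c \<alpha>) * R (e (\<alpha>, j)))"
      by (intro sum.cong) (auto simp: download_def)
    finally show ?thesis .
  qed
  with Q show ?thesis by (rule that)
qed

text \<open>Subtracting a fixed element of a fibre embeds that fibre into the kernel, and there are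
  at most \<open>card K\<close> fibres.\<close>

lemma card_le_card_kernel:
  assumes \<phi>: "klinear_functional K \<phi>" and G: "\<And>x y. x \<in> G \<Longrightarrow> y \<in> G \<Longrightarrow> x - y \<in> G"
  shows "card G \<le> card K * card {x \<in> G. \<phi> x = 0}"
proof -
  have "card {x \<in> G. \<phi> x = y} \<le> card {x \<in> G. \<phi> x = 0}" if "y \<in> \<phi> ` G" for y
  proof -
    from \<open>y \<in> \<phi> ` G\<close> obtain z where z: "z \<in> G" "y = \<phi> z" by blast
    show ?thesis
    proof (rule card_inj_on_le[where f = "\<lambda>x. x - z"])
      show "(\<lambda>x. x - z) ` {x \<in> G. \<phi> x = y} \<subseteq> {x \<in> G. \<phi> x = 0}"
        using z G by (auto simp: klinear_functional_diff[OF \<phi>])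
    qed (auto simp: inj_on_def)
  qed
  then have "(\<Sum>y\<in>\<phi> ` G. card {x \<in> G. \<phi> x = y}) \<le> card (\<phi> ` G) * card {x \<in> G. \<phi> x = 0}"
    using sum_bounded_above[of "\<phi> ` G" "\<lambda>y. card {x \<in> G. \<phi> x = y}"] by simp
  moreover have "card G = (\<Sum>y\<in>\<phi> ` G. card {x \<in> G. \<phi> x = y})"
    using sum.image_gen[of G "\<lambda>_. 1 :: nat" \<phi>] by simp
  moreover have "card (\<phi> ` G) \<le> card K"
    using \<phi> by (intro card_mono) (auto simp: klinear_functional_def)
  ultimately show ?thesis by (auto intro: le_trans[OF _ mult_le_mono1])
qed

text \<open>Each further condition shrinks the solution set by a factor of at most
  \<open>card K\<close>; independence of the \<open>\<rho> j\<close> is not assumed, hence an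
  inequality.\<close>

lemma card_common_kernel:
  assumes \<psi>: "klinear_functional K \<psi>"
  shows "card (UNIV :: 'a set) \<le> card K ^ m * card {x. \<forall>j<m. \<psi> (\<rho> j * x) = 0}"
proof (induction m)
  case (Suc m)
  let ?G = "{x. \<forall>j<m. \<psi> (\<rho> j * x) = 0}"
  have "card ?G \<le> card K * card {x \<in> ?G. \<psi> (\<rho> m * x) = 0}"
    by (rule card_le_card_kernel[OF klinear_functional_mult[OF \<psi>]])
      (auto simp: right_diff_distrib klinear_functional_diff[OF \<psi>])
  moreover have "{x \<in> ?G. \<psi> (\<rho> m * x) = 0} = {x. \<forall>j<Suc m. \<psi> (\<rho> j * x) = 0}"
    by (auto simp: less_Suc_eq)
  ultimately have "card K ^ m * card ?G \<le> card K ^ m * (card K * card {x. \<forall>j<Suc m. \<psi> (\<rho> j * x) = 0})"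
    by (simp only: mult_le_mono2)
  with Suc have "card (UNIV :: 'a set) \<le> card K ^ m * (card K * card {x. \<forall>j<Suc m. \<psi> (\<rho> j * x) = 0})"
    by (rule le_trans)
  then show ?case by (simp only: power_Suc2 mult.assoc)
qed simp

text \<open>Multiplying the recovery formula by \<open>\<gamma>\<close>, applying
  \<open>\<psi>\<close> and writing each query as \<open>\<psi> (\<delta> \<alpha> j * x)\<close>
  turns the scheme into a dual word. Its entry at \<open>\<alpha>\<close> vanishes as soon as
  \<open>b \<alpha>\<close> linear conditions on \<open>\<gamma>\<close> hold.\<close>

lemma repair_scheme_dual_words:
  assumes scheme: "linear_repair_scheme K A C \<alpha>s b" and \<alpha>s: "\<alpha>s \<in> A"
    and C: "\<And>x c. c \<in> C \<Longrightarrow> (\<lambda>\<alpha>. x * c \<alpha>) \<in> C"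
  obtains h where "\<And>\<gamma>. h \<gamma> \<alpha>s = \<gamma>" "\<And>\<gamma> c. c \<in> C \<Longrightarrow> (\<Sum>\<alpha>\<in>A. h \<gamma> \<alpha> * c \<alpha>) = 0"
    "\<And>\<alpha>. \<alpha> \<in> A - {\<alpha>s} \<Longrightarrow> card (UNIV :: 'a set) \<le> card K ^ b \<alpha> * card {\<gamma>. h \<gamma> \<alpha> = 0}"
proof -
  obtain \<psi> where \<psi>: "klinear_functional K \<psi>" "\<psi> \<noteq> (\<lambda>_. 0)"
    using ex_nonzero_klinear_functional by blast
  obtain Q \<rho> where Q: "\<And>\<alpha> j. \<alpha> \<in> A - {\<alpha>s} \<Longrightarrow> j < b \<alpha> \<Longrightarrow> klinear_functional K (Q \<alpha> j)"
    and repair: "\<And>c. c \<in> C \<Longrightarrow> c \<alpha>s = (\<Sum>\<alpha>\<in>A - {\<alpha>s}. \<Sum>j<b \<alpha>. Q \<alpha> j (c \<alpha>) * \<rho> \<alpha> j)"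
    using linear_repair_schemeE[OF scheme] by blast
  have "\<exists>\<delta>. \<alpha> \<in> A - {\<alpha>s} \<longrightarrow> j < b \<alpha> \<longrightarrow> (\<forall>x. Q \<alpha> j x = \<psi> (\<delta> * x))" for \<alpha> j
    using klinear_functional_representation[OF \<psi> Q] by blast
  then obtain \<delta> where \<delta>: "\<And>\<alpha> j x. \<alpha> \<in> A - {\<alpha>s} \<Longrightarrow> j < b \<alpha> \<Longrightarrow> Q \<alpha> j x = \<psi> (\<delta> \<alpha> j * x)"
    by metis
  \<comment> \<open>The scalar \<open>\<psi> (\<rho> \<alpha> j * \<gamma>)\<close> lies in
    \<open>K\<close>, so it may be moved inside \<open>\<psi>\<close> and absorbed into the
    entry.\<close>
  define h where "h \<gamma> \<alpha> = (if \<alpha> = \<alpha>s then \<gamma> else - (\<Sum>j<b \<alpha>. \<psi> (\<rho> \<alpha> j * \<gamma>) * \<delta> \<alpha> j))" for \<gamma> \<alpha>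
  have \<psi>_scale: "\<psi> (\<psi> x * y) = \<psi> x * \<psi> y" for x y
    using \<psi>(1) unfolding klinear_functional_def by blast
  have "\<psi> (\<Sum>\<alpha>\<in>A. h \<gamma> \<alpha> * c \<alpha>) = 0" if c: "c \<in> C" for \<gamma> c
  proof -
    have "\<psi> (\<gamma> * (Q \<alpha> j (c \<alpha>) * \<rho> \<alpha> j)) = \<psi> (\<rho> \<alpha> j * \<gamma>) * \<psi> (\<delta> \<alpha> j * c \<alpha>)"
      if "\<alpha> \<in> A - {\<alpha>s}" "j < b \<alpha>" for \<alpha> j
      using \<psi>_scale[of "\<delta> \<alpha> j * c \<alpha>" "\<rho> \<alpha> j * \<gamma>"] \<delta>[OF that] by (simp add: mult_ac)
    then have "\<psi> (\<gamma> * c \<alpha>s) =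
        (\<Sum>\<alpha>\<in>A - {\<alpha>s}. \<Sum>j<b \<alpha>. \<psi> (\<rho> \<alpha> j * \<gamma>) * \<psi> (\<delta> \<alpha> j * c \<alpha>))"
      by (simp add: repair[OF c] sum_distrib_left klinear_functional_sum_plain[OF \<psi>(1)])
    also have "\<dots> = \<psi> (\<Sum>\<alpha>\<in>A - {\<alpha>s}. \<Sum>j<b \<alpha>. \<psi> (\<rho> \<alpha> j * \<gamma>) * (\<delta> \<alpha> j * c \<alpha>))"
      by (simp add: klinear_functional_sum_plain[OF \<psi>(1)] \<psi>_scale)
    also have "(\<Sum>\<alpha>\<in>A - {\<alpha>s}. \<Sum>j<b \<alpha>. \<psi> (\<rho> \<alpha> j * \<gamma>) * (\<delta> \<alpha> j * c \<alpha>)) =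
        - (\<Sum>\<alpha>\<in>A - {\<alpha>s}. h \<gamma> \<alpha> * c \<alpha>)"
      unfolding sum_negf[symmetric]
      by (intro sum.cong) (auto simp: h_def sum_distrib_right mult.assoc)
    also have "\<dots> = \<gamma> * c \<alpha>s - (\<Sum>\<alpha>\<in>A. h \<gamma> \<alpha> * c \<alpha>)"
      using \<alpha>s by (simp add: sum.remove h_def)
    finally show ?thesis by (simp add: klinear_functional_diff[OF \<psi>(1)])
  qed
  \<comment> \<open>Applied to the scaled codeword \<open>x * c \<alpha>\<close>, the identity holds
    for every multiple of the sum, so nondegeneracy removes \<open>\<psi>\<close>.\<close>
  then have "\<psi> (x * (\<Sum>\<alpha>\<in>A. h \<gamma> \<alpha> * c \<alpha>)) = 0" if "c \<in> C" for \<gamma> c x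
    using C[OF that, of x] by (force simp: sum_distrib_left mult.left_commute)
  then have "(\<Sum>\<alpha>\<in>A. h \<gamma> \<alpha> * c \<alpha>) = 0" if "c \<in> C" for \<gamma> c
    using klinear_functional_nondegenerate[OF \<psi>] that by blast
  moreover have "card (UNIV :: 'a set) \<le> card K ^ b \<alpha> * card {\<gamma>. h \<gamma> \<alpha> = 0}"
    if "\<alpha> \<in> A - {\<alpha>s}" for \<alpha>
  proof -
    have "{\<gamma>. \<forall>j<b \<alpha>. \<psi> (\<rho> \<alpha> j * \<gamma>) = 0} \<subseteq> {\<gamma>. h \<gamma> \<alpha> = 0}" using that by (auto simp: h_def)
    then have "card {\<gamma>. \<forall>j<b \<alpha>. \<psi> (\<rho> \<alpha> j * \<gamma>) = 0} \<le> card {\<gamma>. h \<gamma> \<alpha> = 0}"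
      by (intro card_mono) auto
    then show ?thesis using card_common_kernel[OF \<psi>(1), of "b \<alpha>" "\<rho> \<alpha>"]
      by (meson le_trans mult_le_mono2)
  qed
  ultimately show ?thesis using that[of h] by (simp add: h_def)
qed

text \<open>Double counting of pairs of \<open>\<gamma>\<close> and a node other than
  \<open>\<alpha>s\<close> at which \<open>h \<gamma>\<close> vanishes. By nodes, the kernel bound
  gives the left side. By words, \<open>\<gamma> = 0\<close> contributes at most
  \<open>card A - 1\<close>, and every other \<open>\<gamma>\<close> at most
  \<open>card A - k - 1\<close>.\<close>

lemma RS_repair_scheme_sum_le:
  assumes scheme: "linear_repair_scheme K A (RS A k) \<alpha>s b" and \<alpha>s: "\<alpha>s \<in> A"
  shows "(\<Sum>\<alpha>\<in>A - {\<alpha>s}. real (card (UNIV :: 'a set)) / real (card K) ^ b \<alpha>)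
    \<le> real ((card A - 1) + (card (UNIV :: 'a set) - 1) * (card A - k - 1))"
proof -
  obtain h where h: "\<And>\<gamma>. h \<gamma> \<alpha>s = \<gamma>" "\<And>\<gamma> c. c \<in> RS A k \<Longrightarrow> (\<Sum>\<alpha>\<in>A. h \<gamma> \<alpha> * c \<alpha>) = 0"
    "\<And>\<alpha>. \<alpha> \<in> A - {\<alpha>s} \<Longrightarrow> card (UNIV :: 'a set) \<le> card K ^ b \<alpha> * card {\<gamma>. h \<gamma> \<alpha> = 0}"
    using repair_scheme_dual_words[OF scheme \<alpha>s RS_scale] by blast
  let ?z = "\<lambda>\<gamma>. card {\<alpha> \<in> A - {\<alpha>s}. h \<gamma> \<alpha> = 0}"
  have z: "?z \<gamma> \<le> card A - k - 1" if "\<gamma> \<noteq> 0" for \<gamma>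
  proof -
    have "k < card {\<alpha> \<in> A. h \<gamma> \<alpha> \<noteq> 0}"
      by (rule RS_dual_weight[OF _ h(2) \<alpha>s]) (use h(1) that in auto)
    \<comment> \<open>As \<open>h \<gamma> \<alpha>s = \<gamma>\<close> is nonzero, all zeros of the
      word lie in \<open>A - {\<alpha>s}\<close> and are counted by \<open>?z\<close>.\<close>
    moreover have "card A = card {\<alpha> \<in> A. h \<gamma> \<alpha> \<noteq> 0} + ?z \<gamma>"
      using h(1) that by (subst card_Un_disjoint[symmetric]) (auto intro!: arg_cong[of _ _ card])
    ultimately show ?thesis by simp
  qed
  have "real (card (UNIV :: 'a set)) / real (card K) ^ b \<alpha> \<le> real (card {\<gamma>. h \<gamma> \<alpha> = 0})"
    if "\<alpha> \<in> A - {\<alpha>s}" for \<alpha>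
  proof -
    have "real (card (UNIV :: 'a set)) \<le> real (card K ^ b \<alpha> * card {\<gamma>. h \<gamma> \<alpha> = 0})"
      using h(3)[OF that] by (rule of_nat_mono)
    then show ?thesis using card_ge_2 by (simp add: divide_le_eq mult.commute)
  qed
  then have "(\<Sum>\<alpha>\<in>A - {\<alpha>s}. real (card (UNIV :: 'a set)) / real (card K) ^ b \<alpha>)
      \<le> real (\<Sum>\<alpha>\<in>A - {\<alpha>s}. card {\<gamma>. h \<gamma> \<alpha> = 0})"
    unfolding of_nat_sum by (rule sum_mono)
  also have "(\<Sum>\<alpha>\<in>A - {\<alpha>s}. card {\<gamma>. h \<gamma> \<alpha> = 0}) =
      (\<Sum>\<alpha>\<in>A - {\<alpha>s}. \<Sum>\<gamma>\<in>UNIV. if h \<gamma> \<alpha> = 0 then 1 else 0)"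
    by (simp add: sum.If_cases)
  also have "\<dots> = (\<Sum>\<gamma>\<in>UNIV. \<Sum>\<alpha>\<in>A - {\<alpha>s}. if h \<gamma> \<alpha> = 0 then 1 else 0)"
    by (rule sum.swap)
  also have "\<dots> = (\<Sum>\<gamma>\<in>UNIV. ?z \<gamma>)"
    by (simp add: sum.If_cases Int_def)
  also have "\<dots> = ?z 0 + (\<Sum>\<gamma>\<in>UNIV - {0}. ?z \<gamma>)" by (simp add: sum.remove)
  also have "\<dots> \<le> (card A - 1) + (card (UNIV :: 'a set) - 1) * (card A - k - 1)"
  proof (rule add_mono)
    have "?z 0 \<le> card (A - {\<alpha>s})" by (intro card_mono) auto
    then show "?z 0 \<le> card A - 1" using \<alpha>s by simp
    have "(\<Sum>\<gamma>\<in>UNIV - {0}. ?z \<gamma>) \<le> of_nat (card (UNIV - {0 :: 'a})) * (card A - k - 1)"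
      using z by (intro sum_bounded_above) auto
    then show "(\<Sum>\<gamma>\<in>UNIV - {0}. ?z \<gamma>) \<le> (card (UNIV :: 'a set) - 1) * (card A - k - 1)"
      by (simp add: card_Diff_singleton)
  qed
  finally show ?thesis by simp
qed

end

text \<open>The tangent line inequality \<open>q\<^sup>y \<ge> 1 + y ln q\<close> at \<open>y = t - s - b \<alpha>\<close> replaces Jensen's inequality.\<close>
lemma sum_ge_of_sum_power_le:
  fixes q :: nat and b :: "'i \<Rightarrow> nat"
  assumes q: "q \<ge> 2" and st: "s \<le> t"
    and le: "(\<Sum>i\<in>I. real q ^ t / real q ^ b i) \<le> real (card I) * real q ^ s"
  shows "card I * (t - s) \<le> (\<Sum>i\<in>I. b i)"
proof -
  have q0: "real q > 0" and lnq: "ln (real q) > 0" using q by auto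
  have pow: "real q ^ m = exp (real m * ln (real q))" for m
    using q0 by (simp add: exp_of_nat_mult)
  have "real q ^ s * (1 + (real (t - s) - real (b i)) * ln (real q)) \<le> real q ^ t / real q ^ b i" for i
  proof -
    have "real q ^ s * (1 + (real (t - s) - real (b i)) * ln (real q))
        \<le> real q ^ s * exp ((real (t - s) - real (b i)) * ln (real q))"
      by (intro mult_left_mono exp_ge_add_one_self) auto
    also have "\<dots> = real q ^ t / real q ^ b i"
      unfolding pow using st by (simp add: of_nat_diff left_diff_distrib exp_diff exp_add)
    finally show ?thesis .
  qed
  then have "(\<Sum>i\<in>I. real q ^ s * (1 + (real (t - s) - real (b i)) * ln (real q)))
      \<le> (\<Sum>i\<in>I. real q ^ t / real q ^ b i)"
    by (intro sum_mono)
  with le have "real q ^ s * (\<Sum>i\<in>I. 1 + (real (t - s) - real (b i)) * ln (real q)) \<le> real q ^ s * real (card I)"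
    by (simp add: sum_distrib_left mult.commute)
  then have "(\<Sum>i\<in>I. 1 + (real (t - s) - real (b i)) * ln (real q)) \<le> real (card I)"
    using q0 by simp
  \<comment> \<open>The summands 1 add up to \<open>card I\<close> and cancel; since
    \<open>ln q\<close> is positive, the sign of the remaining linear term is the claim.\<close>
  then have "(real (card I) * real (t - s) - (\<Sum>i\<in>I. real (b i))) * ln (real q) \<le> 0"
    by (simp add: sum.distrib sum_subtractf flip: sum_distrib_right)
  then have "real (card I) * real (t - s) \<le> (\<Sum>i\<in>I. real (b i))"
    using lnq by (simp add: mult_le_0_iff)
  then have "real (card I * (t - s)) \<le> real (\<Sum>i\<in>I. b i)" by simp
  then show ?thesis by (simp only: of_nat_le_iff)
qed

text \<open>A relation among the scaled vectors pulls back along the injective scaling to one among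
  the originals, after cancelling \<open>a\<close>.\<close>

lemma kindep_image_mult:
  fixes K :: "'a::field set"
  assumes "kindep K B" "a \<noteq> 0" shows "kindep K ((*) a ` B)"
  unfolding kindep_def
proof (intro allI impI ballI; elim conjE)
  fix T c y
  assume T: "finite T" "T \<subseteq> (*) a ` B" "\<forall>x\<in>T. c x \<in> K" "(\<Sum>x\<in>T. c x * x) = 0" and y: "y \<in> T"
  obtain S where S: "S \<subseteq> B" "T = (*) a ` S" using T(2) by (auto simp: subset_image_iff)
  have inj: "inj_on ((*) a) S" using assms(2) by (auto simp: inj_on_def)
  have "finite S" using T(1) S(2) inj finite_imageD by blast
  have "a * (\<Sum>x\<in>S. c (a * x) * x) = 0"
    using T(4) unfolding S(2) sum.reindex[OF inj] by (simp add: sum_distrib_left mult.left_commute)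
  then have "(\<Sum>x\<in>S. c (a * x) * x) = 0" using assms(2) by simp
  moreover have "\<forall>x\<in>S. c (a * x) \<in> K" using T(3) S(2) by blast
  ultimately have "c (a * x) = 0" if "x \<in> S" for x
    using assms(1)[unfolded kindep_def, THEN spec[of _ S], THEN spec[of _ "\<lambda>x. c (a * x)"]]
      \<open>finite S\<close> S(1) that by blast
  then show "c y = 0" using y S(2) by blast
qed

section \<open>Repair bandwidth of the scheme and its optimality for the full-length code\<close>

theorem theorem4:
  fixes K :: "'a::{finite,field} set"
    and q t s n k :: nat
    and A W :: "'a set"
    and u :: "nat \<Rightarrow> 'a"
    and \<alpha>s :: 'a
  assumes q_pp: "\<exists>p m. prime p \<and> m > 0 \<and> q = p ^ m"
    and t_pos: "t \<ge> 1"
    and K_sub: "is_subfield K" and K_card: "card K = q"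
    and F_card: "card (UNIV :: 'a set) = q ^ t"
    and A_card: "card A = n"
    and s_lt: "s < t"
    and r_ge: "n - k \<ge> q ^ s"
    and u_basis: "inj_on u {1..t}" "kindep K (u ` {1..t})" "kspan K (u ` {1..t}) = UNIV"
    and W_sub: "ksubspace K W" and W_dim: "kdim K W = s"
    and \<alpha>s_in: "\<alpha>s \<in> A"
  shows
    "(\<forall>i\<in>{1..t}. degree (check_poly W (u i) \<alpha>s) = q ^ s - 1
                 \<and> degree (check_poly W (u i) \<alpha>s) \<le> (n - k) - 1)
     \<and> krank K {poly (check_poly W (u i) \<alpha>s) \<alpha>s | i. i \<in> {1..t}} = t
     \<and> linear_repair_scheme K A (RS A k) \<alpha>s
         (\<lambda>\<alpha>. krank K {poly (check_poly W (u i) \<alpha>s) \<alpha> | i. i \<in> {1..t}})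
     \<and> bandwidth_bits A \<alpha>s
         (\<lambda>\<alpha>. krank K {poly (check_poly W (u i) \<alpha>s) \<alpha> | i. i \<in> {1..t}}) q
       \<le> real ((n - 1) * (t - s)) * log 2 (real q)
     \<and> (n = q ^ t \<and> n - k = q ^ s \<longrightarrow>
          (\<forall>b. linear_repair_scheme K A (RS A k) \<alpha>s b \<longrightarrow>
               real ((n - 1) * (t - s)) * log 2 (real q) \<le> bandwidth_bits A \<alpha>s b q))"
proof -
  interpret finite_subfield K by standard (rule K_sub)
  define g where "g i = poly (check_poly W (u i) \<alpha>s)" for i
  have image_eq: "{poly (check_poly W (u i) \<alpha>s) \<alpha> | i. i \<in> {1..t}} = (\<lambda>i. g i \<alpha>) ` {1..t}" for \<alpha>
    by (auto simp: g_def)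
  have W0: "0 \<in> W" using W_sub by (simp add: ksubspace_def)
  have card_W: "card W = q ^ s" using card_ksubspace[OF W_sub] K_card W_dim by simp
  have q2: "q \<ge> 2" using card_ge_2 K_card by simp
  have u_nz: "u i \<noteq> 0" if "i \<in> {1..t}" for i
  proof
    assume "u i = 0"
    then show False
      using u_basis(2)[unfolded kindep_def, rule_format, of "{u i}" "\<lambda>_. 1" "u i"] that by simp
  qed
  have deg: "degree (check_poly W (u i) \<alpha>s) = q ^ s - 1" if "i \<in> {1..t}" for i
    using degree_check_poly[OF W0 u_nz[OF that]] card_W by simp
  \<comment> \<open>The coefficient of \<open>x\<close> in the subspace polynomial, by which every
    basis element is scaled at \<open>\<alpha>s\<close>.\<close>
  define \<kappa> where "\<kappa> = (\<Prod>w\<in>W - {0}. - w)"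
  have \<kappa>: "\<kappa> \<noteq> 0" by (simp add: \<kappa>_def)
  have g_center: "g i \<alpha>s = \<kappa> * u i" for i
    by (simp add: g_def \<kappa>_def poly_check_poly_center[OF W0])
  then have img: "(\<lambda>i. g i \<alpha>s) ` {1..t} = (*) \<kappa> ` u ` {1..t}" by (simp add: image_image)
  have inj: "inj_on (\<lambda>i. g i \<alpha>s) {1..t}"
    using inj_onD[OF u_basis(1)] \<kappa> by (intro inj_onI) (simp add: g_center)
  have indep: "kindep K ((\<lambda>i. g i \<alpha>s) ` {1..t})"
    unfolding img by (rule kindep_image_mult[OF u_basis(2) \<kappa>])
  have card_span: "card (kspan K ((\<lambda>i. g i \<alpha>s) ` {1..t})) = q ^ t"
    using card_kspan[OF indep] card_image[OF inj] K_card by simp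
  then have span: "kspan K ((\<lambda>i. g i \<alpha>s) ` {1..t}) = UNIV"
    using F_card by (intro card_subset_eq) auto
  have rank: "krank K ((\<lambda>i. g i \<alpha>s) ` {1..t}) = t"
    using card_span card_kspan_krank[of "(\<lambda>i. g i \<alpha>s) ` {1..t}"] K_card q2 by simp
  have rank_le: "krank K ((\<lambda>i. g i \<alpha>) ` {1..t}) \<le> t - s" if "\<alpha> \<noteq> \<alpha>s" for \<alpha>
  proof -
    have "q ^ (krank K ((\<lambda>i. g i \<alpha>) ` {1..t}) + s) \<le> q ^ t"
      using krank_check_poly_values[OF W_sub that, of u "{1..t}"] K_card card_W F_card
      by (simp add: power_add g_def)
    then show ?thesis using q2 by simp
  qed
  have scheme: "linear_repair_scheme K A (RS A k) \<alpha>s (\<lambda>\<alpha>. krank K ((\<lambda>i. g i \<alpha>) ` {1..t}))"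
  proof -
    obtain \<mu> where \<mu>: "\<And>\<alpha>. \<alpha> \<in> A \<Longrightarrow> \<mu> \<alpha> \<noteq> 0"
      "\<And>p. degree p < card A - 1 \<Longrightarrow> (\<Sum>\<alpha>\<in>A. \<mu> \<alpha> * poly p \<alpha>) = 0"
      using ex_lagrange_multipliers[of A] by auto
    have "(\<Sum>\<alpha>\<in>A. \<mu> \<alpha> * g i \<alpha> * c \<alpha>) = 0" if i: "i \<in> {1..t}" and c: "c \<in> RS A k" for i c
    proof -
      obtain f where f: "f = 0 \<or> degree f < k" "\<forall>\<alpha>\<in>A. c \<alpha> = poly f \<alpha>"
        using c unfolding RS_def by blast
      let ?h = "check_poly W (u i) \<alpha>s"
      have "(\<Sum>\<alpha>\<in>A. \<mu> \<alpha> * poly (?h * f) \<alpha>) = 0"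
      proof (cases "f = 0")
        case False
        have "degree (?h * f) \<le> degree ?h + degree f" by (rule degree_mult_le)
        \<comment> \<open>Positivity makes \<open>n - k\<close> an untruncated difference; then the
          degree is at most \<open>(q ^ s - 1) + (k - 1) \<le> n - 2\<close>.\<close>
        moreover have "q ^ s > 0" using q2 by simp
        ultimately have "degree (?h * f) < card A - 1"
          using False f(1) deg[OF i] r_ge A_card by linarith
        then show ?thesis by (rule \<mu>(2))
      qed simp
      then show ?thesis using f(2) by (simp add: g_def mult.assoc)
    qed
    then show ?thesis
      by (intro linear_repair_scheme_of_checks[where \<mu> = \<mu>] \<alpha>s_in inj indep span) (use \<mu>(1) \<alpha>s_in in auto)
  qed
  have card_others: "card (A - {\<alpha>s}) = n - 1" using \<alpha>s_in A_card by simp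
  have log_nonneg: "log 2 (real q) \<ge> 0" using q2 by simp
  have "(\<Sum>\<alpha>\<in>A - {\<alpha>s}. krank K ((\<lambda>i. g i \<alpha>) ` {1..t})) \<le> (n - 1) * (t - s)"
    using sum_bounded_above[of "A - {\<alpha>s}" "\<lambda>\<alpha>. krank K ((\<lambda>i. g i \<alpha>) ` {1..t})" "t - s"]
      rank_le card_others by simp
  then have upper: "bandwidth_bits A \<alpha>s (\<lambda>\<alpha>. krank K ((\<lambda>i. g i \<alpha>) ` {1..t})) q
      \<le> real ((n - 1) * (t - s)) * log 2 (real q)"
    unfolding bandwidth_bits_def by (intro mult_right_mono log_nonneg of_nat_mono)
  have lower: "real ((n - 1) * (t - s)) * log 2 (real q) \<le> bandwidth_bits A \<alpha>s b q"
    if n: "n = q ^ t" and r: "n - k = q ^ s" and b: "linear_repair_scheme K A (RS A k) \<alpha>s b" for b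
  proof -
    \<comment> \<open>At full length the zero count is exactly \<open>q ^ s\<close> per remaining
      node on average, which is the form required by the convexity bound.\<close>
    have eq: "n - 1 + (q ^ t - 1) * (q ^ s - 1) = (n - 1) * q ^ s"
      using q2 n by (cases "q ^ s") auto
    have "(\<Sum>\<alpha>\<in>A - {\<alpha>s}. real (q ^ t) / real q ^ b \<alpha>)
        \<le> real (n - 1 + (q ^ t - 1) * (q ^ s - 1))"
      using RS_repair_scheme_sum_le[OF b \<alpha>s_in] by (simp only: F_card K_card A_card r)
    then have "(\<Sum>\<alpha>\<in>A - {\<alpha>s}. real q ^ t / real q ^ b \<alpha>) \<le> real (card (A - {\<alpha>s})) * real q ^ s"
      by (simp only: eq card_others of_nat_mult of_nat_power)
    then have "card (A - {\<alpha>s}) * (t - s) \<le> (\<Sum>\<alpha>\<in>A - {\<alpha>s}. b \<alpha>)"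
      using q2 s_lt by (intro sum_ge_of_sum_power_le) auto
    then show ?thesis
      unfolding bandwidth_bits_def card_others by (intro mult_right_mono log_nonneg of_nat_mono)
  qed
  have "q ^ s - 1 \<le> (n - k) - 1" using r_ge by simp
  with deg have "\<forall>i\<in>{1..t}. degree (check_poly W (u i) \<alpha>s) = q ^ s - 1
      \<and> degree (check_poly W (u i) \<alpha>s) \<le> (n - k) - 1" by simp
  with rank scheme upper lower show ?thesis unfolding image_eq by blast
qed

end
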